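(* There exist constants $c>0$ and $c''>0$ such that for every sufficiently large $n$ that is a power of $2$, there is a sub-collection $\mathcal{P}^*\subseteq\mathcal{P}$ with $|\mathcal{P}^*|\ge 2^{c'' n\log n}$ such that for any two distinct $P_1,P_2\in\mathcal{P}^*$, $$\mathrm{disc}(P_1\uplus P_2,\mathcal{R}_2)\ge c\log n .$$
   Context: Logarithms are base 2. $\mathcal{P}$ denotes the collection of all sets of $n$ points drawn from an $n\times n$ grid. $\mathcal{R}_2$ is the set of all axis-parallel rectangles in the plane. For a finite multiset $X$ of points, $\mathrm{disc}(X,\mathcal{R}_2)=\min_{\chi}\max_{R\in\mathcal{R}_2}\bigl|\sum_{p\in X\cap R}\chi(p)\bigr|$, where $\chi$ ranges over all assignments of a color in $\{-1,+1\}$ to each element of $X$ (elements counted with multiplicity). $P_1\uplus P_2$ denotes the union of $P_1$ and $P_2$ as a multiset (a point lying in both sets appears twice). *)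

theory Defs
  imports Complex_Main "HOL-Library.Multiset" "HOL-Library.FuncSet"
begin

definition grid :: "nat \<Rightarrow> (real \<times> real) set" where
  "grid n = {(real i, real j) | i j. i \<in> {1..n} \<and> j \<in> {1..n}}"

definition grid_point_sets :: "nat \<Rightarrow> (real \<times> real) set set" where
  "grid_point_sets n = {P. P \<subseteq> grid n \<and> card P = n}"

definition axis_rectangles :: "(real \<times> real) set set" where
  "axis_rectangles = {{a..b} \<times> {c..d} | a b c d. a < b \<and> c < d}"

text \<open>The pair \<open>(p, i)\<close> is the \<open>i\<close>-th copy of \<open>p\<close> in the multiset; different copies of the
  same point may receive different colors.\<close>

definition mset_elems :: "'a multiset \<Rightarrow> ('a \<times> nat) set" where
  "mset_elems X = {(p, i). i < count X p}"

definition colorings :: "'a multiset \<Rightarrow> ('a \<times> nat \<Rightarrow> int) set" where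
  "colorings X = mset_elems X \<rightarrow>\<^sub>E {-1, 1}"

definition imbalance :: "'a multiset \<Rightarrow> ('a \<times> nat \<Rightarrow> int) \<Rightarrow> 'a set \<Rightarrow> int" where
  "imbalance X \<chi> R = \<bar>\<Sum>e \<in> {e \<in> mset_elems X. fst e \<in> R}. \<chi> e\<bar>"

definition disc :: "'a multiset \<Rightarrow> 'a set set \<Rightarrow> int" where
  "disc X \<R> = Min ((\<lambda>\<chi>. Max (imbalance X \<chi> ` \<R>)) ` colorings X)"

text \<open>The facts below show that \<open>Min\<close> and \<open>Max\<close> are taken over finite nonempty sets, even though
  the family of ranges may be infinite.\<close>

lemma finite_mset_elems [simp]: "finite (mset_elems X)"
proof -
  have "mset_elems X = (SIGMA p:set_mset X. {..<count X p})"
    by (auto simp: mset_elems_def dest: gr_implies_not0 simp flip: count_greater_zero_iff)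
  then show ?thesis by simp
qed

lemma finite_colorings: "finite (colorings X)"
  by (simp add: colorings_def finite_PiE)

lemma colorings_nonempty: "colorings X \<noteq> {}"
  by (simp add: colorings_def PiE_eq_empty_iff)

lemma finite_imbalance_image: "finite (imbalance X \<chi> ` \<R>)"
proof -
  have "imbalance X \<chi> ` \<R> \<subseteq> (\<lambda>E. \<bar>\<Sum>e\<in>E. \<chi> e\<bar>) ` Pow (mset_elems X)"
    by (auto simp: imbalance_def)
  then show ?thesis by (rule finite_subset) simp
qed

lemma axis_rectangles_nonempty: "axis_rectangles \<noteq> {}"
proof -
  have "{0..1::real} \<times> {0..1::real} \<in> axis_rectangles"
    unfolding axis_rectangles_def using zero_less_one by blast
  then show ?thesis by blast
qed

end

theory Submission
  imports Defs
begin

text \<open>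
  For a set \<open>S\<close> of flips, reversing the binary digits of \<open>x\<close> and flipping the digit that splits each
  chosen dyadic cell of area \<open>2n\<close> gives a net: one point in every dyadic cell of area \<open>n\<close>. Only
  \<open>\<Theta>(n log n)\<close> well separated flips are used, and a Gilbert--Varshamov code of flip sets provides
  \<open>2 ^ \<Omega>(n log n)\<close> nets that pairwise differ in a constant fraction of the flips.

  For two such nets and a coloring, the signed counting function \<open>D\<close> of lower left rectangles is
  tested against a Riesz product \<open>\<Prod>(1 + \<gamma> f\<^sub>a)\<close> (Halasz, Schmidt), where \<open>f\<^sub>a\<close> combines Haar-like functions on
  the cells of one shape with signs of our choice. A cell holds one point of each net and contributes
  \<open>\<bar>\<plusminus> V\<^sub>1 \<plusminus> V\<^sub>2\<bar> \<ge> \<bar>V\<^sub>1 - V\<^sub>2\<bar>\<close> with nonnegative \<open>V\<^sub>1, V\<^sub>2\<close>, so every flip in which the nets differ contributes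
  \<open>\<Omega>(n)\<close> whatever the coloring is. The terms of order two and higher in the Riesz product are
  \<open>O(\<gamma>\<^sup>2 n\<^sup>2 log n)\<close>, and its total mass is \<open>n\<^sup>2\<close>; hence \<open>D\<close> reaches \<open>\<Omega>(log n)\<close>.
\<close>

section \<open>Haar-like step functions\<close>

text \<open>The zero quarters distinguish this from a Haar function: they make its tail sums flat on
  the second and on the fourth quarter, the two positions between which a flip moves a
  point.\<close>

definition qstep :: "nat \<Rightarrow> nat \<Rightarrow> real" where
  "qstep q x = (if (x div 2^q) mod 4 = 0 then -1 else if (x div 2^q) mod 4 = 2 then 1 else 0)"

text \<open>The sum of \<open>qstep q\<close> over the part of the block of \<open>p\<close> that starts at \<open>p\<close>
  (\<open>sum_qstep_tail_block\<close>); constant on the second and zero on the fourth quarter.\<close>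

definition ramp :: "nat \<Rightarrow> nat \<Rightarrow> real" where
  "ramp q p = (let Q = 2^q; z = p mod (4 * Q) in real (min Q (3 * Q - z)) - real (Q - z))"

lemma ramp_nonneg: "0 \<le> ramp q p"
  by (auto simp: ramp_def Let_def min_def)

lemma ramp_le: "ramp q p \<le> 2 ^ q"
proof -
  define Q :: nat where "Q = 2^q"
  have "real (min Q (3 * Q - z)) - real (Q - z) \<le> real Q" for z
    by (simp add: min_def)
  from this[of "p mod (4 * Q)"] show ?thesis by (simp add: ramp_def Let_def Q_def)
qed

lemma mod_four_mult_bounds:
  fixes p Q :: nat
  assumes "Q > 0" "(p div Q) mod 4 = j"
  shows "j * Q \<le> p mod (4 * Q)" "p mod (4 * Q) < j * Q + Q"
proof -
  have "p mod (4 * Q) = Q * (p div Q mod 4) + p mod Q"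
    by (metis mod_mult2_eq mult.commute)
  then have "p mod (4 * Q) = j * Q + p mod Q"
    using assms by (simp add: mult.commute)
  then show "j * Q \<le> p mod (4 * Q)" "p mod (4 * Q) < j * Q + Q"
    using assms by auto
qed

lemma ramp_second_quarter:
  assumes "(p div 2^q) mod 4 = 1"
  shows "ramp q p = 2 ^ q"
  using mod_four_mult_bounds[OF _ assms] by (auto simp: ramp_def Let_def min_def)

lemma ramp_fourth_quarter:
  assumes "(p div 2^q) mod 4 = 3"
  shows "ramp q p = 0"
  using mod_four_mult_bounds[OF _ assms] by (auto simp: ramp_def Let_def min_def)

text \<open>The truncated subtractions in \<open>ramp\<close> count the positions from
  \<open>p\<close> on in the third and in the first quarter; each count is zero once
  \<open>p\<close> has passed that quarter.\<close>

lemma sum_qstep_tail_block: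
  assumes "p < 4 * 2^q"
  shows "(\<Sum>z<4*2^q. qstep q z * of_bool (p \<le> z)) = ramp q p"
proof -
  define Q :: nat where "Q = 2^q"
  have Q: "Q > 0" by (simp add: Q_def)
  define pat :: "nat \<Rightarrow> real" where "pat m = (if m = 0 then -1 else if m = 2 then 1 else 0)" for m
  have tail: "(\<Sum>z\<in>{m*Q..<m*Q+Q}. of_bool (p \<le> z)) = real (m*Q+Q - max (m*Q) p)" for m
  proof -
    have "(\<Sum>z\<in>{m*Q..<m*Q+Q}. of_bool (p \<le> z)) = real (card {z\<in>{m*Q..<m*Q+Q}. p \<le> z})"
      by (simp add: of_bool_def sum.If_cases Int_def)
    also have "{z\<in>{m*Q..<m*Q+Q}. p \<le> z} = {max (m*Q) p..<m*Q+Q}" by auto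
    finally show ?thesis by simp
  qed
  have "(\<Sum>z<4*Q. qstep q z * of_bool (p \<le> z))
      = (\<Sum>m<4. \<Sum>z\<in>{m*Q..<m*Q+Q}. qstep q z * of_bool (p \<le> z))"
    by (rule sum.nat_group[symmetric])
  also have "\<dots> = (\<Sum>m<4. pat m * real (m*Q+Q - max (m*Q) p))"
  proof (rule sum.cong[OF refl])
    fix m :: nat assume "m \<in> {..<4}"
    have "z div Q = m" if "z \<in> {m*Q..<m*Q+Q}" for z
      using that Q by (intro div_nat_eqI) (auto simp: algebra_simps)
    then have "(\<Sum>z\<in>{m*Q..<m*Q+Q}. qstep q z * of_bool (p \<le> z))
      = (\<Sum>z\<in>{m*Q..<m*Q+Q}. pat m * of_bool (p \<le> z))"
      using \<open>m \<in> _\<close> by (intro sum.cong) (auto simp: qstep_def pat_def simp flip: Q_def)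
    then show "(\<Sum>z\<in>{m*Q..<m*Q+Q}. qstep q z * of_bool (p \<le> z)) = pat m * real (m*Q+Q - max (m*Q) p)"
      by (simp add: tail flip: sum_distrib_left)
  qed
  also have "\<dots> = real (3*Q - max (2*Q) p) - real (Q - p)"
    by (simp add: eval_nat_numeral pat_def)
  also have "\<dots> = ramp q p"
    using assms by (auto simp: ramp_def Let_def min_def max_def simp flip: Q_def)
  finally show ?thesis by (simp add: Q_def)
qed

text \<open>Blocks before that of \<open>p\<close> are cut off by the indicator, and blocks after it
  cancel because \<open>qstep\<close> has mean zero on a block.\<close>

lemma sum_blocks_qstep_tail:
  fixes c :: "nat \<Rightarrow> real"
  assumes p: "p < 2^k" and k: "q + 2 \<le> k"
  shows "(\<Sum>x<2^k. c (x div 2^(q+2)) * qstep q x * of_bool (p \<le> x)) = c (p div 2^(q+2)) * ramp q p"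
proof -
  define W :: nat where "W = 2^(q+2)"
  have W: "W = 4 * 2^q" "W > 0" by (simp_all add: W_def)
  define N :: nat where "N = 2^(k-q-2)"
  have NW: "(2::nat)^k = N * W" 
    unfolding N_def W_def power_add[symmetric] using k by (intro arg_cong2[where f=power]) auto
  have "(\<Sum>x<2^k. c (x div W) * qstep q x * of_bool (p \<le> x))
     = (\<Sum>m<N. \<Sum>x\<in>{m*W..<m*W+W}. c (x div W) * qstep q x * of_bool (p \<le> x))"
    unfolding NW by (rule sum.nat_group[symmetric])
  also have "\<dots> = (\<Sum>m<N. if m = p div W then c (p div W) * ramp q p else 0)"
  proof (rule sum.cong[OF refl])
    fix m :: nat assume "m \<in> {..<N}"
    have qstep: "qstep q (m * W + z) = qstep q z" for z
    proof -
      have "(m * W + z) div 2^q = 4 * m + z div 2^q"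
        using div_mult_self1[of "2^q" z "4 * m"] by (simp add: W(1) ac_simps)
      then show ?thesis by (simp add: qstep_def)
    qed
    have "(\<Sum>x\<in>{m*W..<m*W+W}. c (x div W) * qstep q x * of_bool (p \<le> x))
      = (\<Sum>z<W. c ((m*W+z) div W) * qstep q (m*W+z) * of_bool (p \<le> m*W+z))"
      using sum.shift_bounds_nat_ivl[of "\<lambda>x. c (x div W) * qstep q x * of_bool (p \<le> x)" 0 "m*W" W]
      unfolding atLeast0LessThan add_0 add.commute[of W] by (simp only: add.commute[of "m*W"])
    also have "\<dots> = c m * (\<Sum>z<W. qstep q z * of_bool (p \<le> m*W+z))"
      unfolding sum_distrib_left using W(2) by (intro sum.cong) (auto simp: qstep)
    also have "\<dots> = (if m = p div W then c (p div W) * ramp q p else 0)"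
    proof (cases m "p div W" rule: linorder_cases)
      case less
      then have "(m+1) * W \<le> p" using W(2) by (metis Suc_eq_plus1 Suc_leI less_eq_div_iff_mult_less_eq)
      then show ?thesis using less by (auto intro!: sum.neutral)
    next
      case equal
      have "(p \<le> m*W+z) = (p mod W \<le> z)" for z
        using div_mult_mod_eq[of p W] equal by (smt (verit) nat_add_left_cancel_le)
      then have "(\<Sum>z<W. qstep q z * of_bool (p \<le> m*W+z)) = ramp q (p mod W)"
        using sum_qstep_tail_block[of "p mod W" q] W by simp
      also have "\<dots> = ramp q p" by (simp add: ramp_def W(1))
      finally show ?thesis using equal by simp
    next
      case greater
      then have "p < m * W" using W(2) by (simp add: div_less_iff_less_mult)
      then have "(\<Sum>z<W. qstep q z * of_bool (p \<le> m*W+z)) = (\<Sum>z<4*2^q. qstep q z * of_bool (0 \<le> z))"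
        unfolding W(1)[symmetric] by (intro sum.cong) auto
      also have "\<dots> = 0" by (subst sum_qstep_tail_block) (auto simp: ramp_def)
      finally show ?thesis using greater by simp
    qed
    finally show "(\<Sum>x\<in>{m*W..<m*W+W}. c (x div W) * qstep q x * of_bool (p \<le> x))
      = (if m = p div W then c (p div W) * ramp q p else 0)" .
  qed
  also have "\<dots> = c (p div W) * ramp q p"
    using p W(2) by (simp add: NW div_less_iff_less_mult)
  finally show ?thesis by (simp add: W_def)
qed

lemma sum_blocks_qstep:
  fixes c :: "nat \<Rightarrow> real"
  assumes "q + 2 \<le> k"
  shows "(\<Sum>x<2^k. c (x div 2^(q+2)) * qstep q x) = 0"
  using sum_blocks_qstep_tail[OF _ assms, of 0 c] by (simp add: ramp_def)

lemma sum_cells_qstep_tail: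
  fixes C :: "nat \<Rightarrow> nat \<Rightarrow> real"
  assumes "p < 2^k" "p' < 2^k" "q + 2 \<le> k" "r + 2 \<le> k"
  shows "(\<Sum>x<2^k. \<Sum>y<2^k. C (x div 2^(q+2)) (y div 2^(r+2)) * qstep q x * qstep r y
            * of_bool (p \<le> x) * of_bool (p' \<le> y))
       = C (p div 2^(q+2)) (p' div 2^(r+2)) * ramp q p * ramp r p'"
proof -
  have "(\<Sum>x<2^k. \<Sum>y<2^k. C (x div 2^(q+2)) (y div 2^(r+2)) * qstep q x * qstep r y
            * of_bool (p \<le> x) * of_bool (p' \<le> y))
     = (\<Sum>x<2^k. qstep q x * of_bool (p \<le> x) *
         (\<Sum>y<2^k. C (x div 2^(q+2)) (y div 2^(r+2)) * qstep r y * of_bool (p' \<le> y)))"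
    unfolding sum_distrib_left by (simp add: mult_ac)
  also have "\<dots> = (\<Sum>x<2^k. C (x div 2^(q+2)) (p' div 2^(r+2)) * qstep q x * of_bool (p \<le> x)) * ramp r p'"
    by (subst sum_blocks_qstep_tail[OF assms(2,4)]) (simp add: sum_distrib_left sum_distrib_right mult_ac)
  also have "\<dots> = C (p div 2^(q+2)) (p' div 2^(r+2)) * ramp q p * ramp r p'"
    by (subst sum_blocks_qstep_tail[OF assms(1,3)]) simp
  finally show ?thesis .
qed

section \<open>Riesz products\<close>

text \<open>Sorts the monomials by largest index; the reversed version sorts by smallest. The first
  yields the mass of the Riesz product. The second applied inside the first leaves the linear terms
  and, for each \<open>b < a\<close>, the two outermost factors times everything in between.\<close>

lemma prod_one_plus_telescope:
  fixes f :: "nat \<Rightarrow> 'a::comm_semiring_1"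
  shows "(\<Prod>i<m. 1 + f i) = 1 + (\<Sum>i<m. f i * (\<Prod>j<i. 1 + f j))"
proof (induction m)
  case (Suc m)
  have "(\<Prod>i<Suc m. 1 + f i) = (\<Prod>i<m. 1 + f i) + f m * (\<Prod>i<m. 1 + f i)"
    by (simp add: algebra_simps)
  also have "\<dots> = 1 + (\<Sum>i<m. f i * (\<Prod>j<i. 1 + f j)) + f m * (\<Prod>i<m. 1 + f i)"
    by (simp only: Suc)
  finally show ?case by (simp add: add.assoc)
qed simp

lemma prod_one_plus_telescope_rev:
  fixes f :: "nat \<Rightarrow> 'a::comm_semiring_1"
  shows "(\<Prod>i<m. 1 + f i) = 1 + (\<Sum>i<m. f i * (\<Prod>j\<in>{i<..<m}. 1 + f j))"
proof (induction m)
  case (Suc m)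
  have "(\<Sum>i<m. f i * (\<Prod>j\<in>{i<..<Suc m}. 1 + f j))
      = (\<Sum>i<m. f i * (\<Prod>j\<in>{i<..<m}. 1 + f j)) * (1 + f m)"
    unfolding sum_distrib_right
  proof (rule sum.cong[OF refl])
    fix i assume "i \<in> {..<m}"
    then have "{i<..<Suc m} = insert m {i<..<m}" by auto
    then show "f i * (\<Prod>j\<in>{i<..<Suc m}. 1 + f j) = f i * (\<Prod>j\<in>{i<..<m}. 1 + f j) * (1 + f m)"
      by (simp add: mult_ac)
  qed
  moreover have "{m<..<Suc m} = {}" by auto
  ultimately show ?case by (simp add: Suc algebra_simps)
qed simp

lemma div_round_down:
  fixes x :: nat
  assumes "m \<le> q"
  shows "x div 2^m * 2^m div 2^q = x div 2^q"
proof -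
  have "(2::nat)^q = 2^m * 2^(q-m)" using assms by (simp flip: power_add)
  then show ?thesis by (simp add: div_mult2_eq)
qed

lemma qstep_round_down: "m \<le> q \<Longrightarrow> qstep q (x div 2^m * 2^m) = qstep q x"
  by (simp add: qstep_def div_round_down)

lemma abs_qstep_le: "\<bar>qstep q x\<bar> \<le> 1"
  by (simp add: qstep_def)

lemma sum_quarter_powers_le: "(\<Sum>b<a. (1/4::real)^(a-b)) \<le> 1/3"
proof -
  have "(\<Sum>b<a. (1/4::real)^(a-b)) = (1 - (1/4)^a) / 3"
    by (induction a) (simp_all add: Suc_diff_le sum_distrib_left[symmetric] flip: sum_divide_distrib)
  then show ?thesis by simp
qed

text \<open>Level \<open>a\<close> stands for the cell shape \<open>2^(3a+2)\<close> by
  \<open>2^(k-3a-2)\<close>. Steps of three digits let the interaction of two levels decay by 8 per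
  level against a growth of at most 2, and keep the digits next to a flip unflipped.\<close>

locale signed_points =
  fixes k M :: nat and E :: "'e set" and px py :: "'e \<Rightarrow> nat" and \<chi> :: "'e \<Rightarrow> real"
  assumes levels: "a < M \<Longrightarrow> 3 * a + 4 \<le> k"
    and finite_E: "finite E"
    and px: "e \<in> E \<Longrightarrow> px e < 2^k"
    and py: "e \<in> E \<Longrightarrow> py e < 2^k"
    and \<chi>: "e \<in> E \<Longrightarrow> \<bar>\<chi> e\<bar> \<le> 1"
begin

definition D :: "nat \<Rightarrow> nat \<Rightarrow> real" where
  "D X Y = (\<Sum>e\<in>E. \<chi> e * of_bool (px e \<le> X) * of_bool (py e \<le> Y))"

definition pairing :: "(nat \<Rightarrow> nat \<Rightarrow> real) \<Rightarrow> real" where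
  "pairing F = (\<Sum>X<2^k. \<Sum>Y<2^k. D X Y * F X Y)"

text \<open>On admissible levels this makes the area of a cell \<open>2^k\<close>, so that a net of
  \<open>2^k\<close> points has exactly one point in each cell.\<close>

definition row_exp :: "nat \<Rightarrow> nat" where "row_exp a = k - 4 - 3 * a"

definition cell :: "nat \<Rightarrow> 'e \<Rightarrow> nat \<times> nat" where
  "cell a e = (px e div 2^(3*a+2), py e div 2^(row_exp a + 2))"

definition weight :: "nat \<Rightarrow> nat \<times> nat \<Rightarrow> real" where
  "weight a c = (\<Sum>e | e \<in> E \<and> cell a e = c. \<chi> e * (ramp (3*a) (px e) * ramp (row_exp a) (py e)))"

text \<open>The sign of each cell is read off from the coloring, so that different cells cannot
  cancel when this is paired with \<open>D\<close>.\<close>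

definition haar :: "nat \<Rightarrow> nat \<Rightarrow> nat \<Rightarrow> real" where
  "haar a X Y = sgn (weight a (X div 2^(3*a+2), Y div 2^(row_exp a + 2))) * qstep (3*a) X * qstep (row_exp a) Y"

definition cells :: "nat \<Rightarrow> (nat \<times> nat) set" where
  "cells a = {..<2^(k-3*a-2)} \<times> {..<2^(3*a+2)}"

lemma abs_haar_le: "\<bar>haar a X Y\<bar> \<le> 1"
proof -
  have "\<bar>haar a X Y\<bar> \<le> 1 * 1 * 1"
    unfolding haar_def abs_mult by (intro mult_mono abs_qstep_le) (auto simp: sgn_if)
  then show ?thesis by simp
qed

lemma pairing_qstep:
  assumes "q + 2 \<le> k" "r + 2 \<le> k"
  shows "pairing (\<lambda>X Y. C (X div 2^(q+2)) (Y div 2^(r+2)) * qstep q X * qstep r Y)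
    = (\<Sum>e\<in>E. \<chi> e * (C (px e div 2^(q+2)) (py e div 2^(r+2)) * ramp q (px e) * ramp r (py e)))"
proof -
  have "pairing (\<lambda>X Y. C (X div 2^(q+2)) (Y div 2^(r+2)) * qstep q X * qstep r Y)
    = (\<Sum>X<2^k. \<Sum>Y<2^k. \<Sum>e\<in>E. \<chi> e * (C (X div 2^(q+2)) (Y div 2^(r+2)) * qstep q X * qstep r Y
         * of_bool (px e \<le> X) * of_bool (py e \<le> Y)))"
    unfolding pairing_def D_def sum_distrib_right by (simp add: mult_ac)
  also have "\<dots> = (\<Sum>X<2^k. \<Sum>e\<in>E. \<Sum>Y<2^k. \<chi> e * (C (X div 2^(q+2)) (Y div 2^(r+2)) * qstep q X * qstep r Y
         * of_bool (px e \<le> X) * of_bool (py e \<le> Y)))"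
    by (intro sum.cong refl sum.swap)
  also have "\<dots> = (\<Sum>e\<in>E. \<chi> e * (\<Sum>X<2^k. \<Sum>Y<2^k. C (X div 2^(q+2)) (Y div 2^(r+2)) * qstep q X * qstep r Y
         * of_bool (px e \<le> X) * of_bool (py e \<le> Y)))"
    unfolding sum_distrib_left by (rule sum.swap)
  also have "\<dots> = (\<Sum>e\<in>E. \<chi> e * (C (px e div 2^(q+2)) (py e div 2^(r+2)) * ramp q (px e) * ramp r (py e)))"
    by (intro sum.cong refl arg_cong2[where f="(*)"] sum_cells_qstep_tail px py assms)
  finally show ?thesis .
qed

lemma row_exp_bound: "a < M \<Longrightarrow> row_exp a + 2 \<le> k" "a < M \<Longrightarrow> row_exp a + 2 = k - 3*a - 2"
  using levels[of a] by (auto simp: row_exp_def)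

lemma cell_in_cells:
  assumes "a < M" "e \<in> E"
  shows "cell a e \<in> cells a"
proof -
  have "(2::nat)^k = 2^(k-3*a-2) * 2^(3*a+2)"
    unfolding power_add[symmetric] using levels[OF assms(1)]
    by (intro arg_cong2[where f=power]) auto
  then show ?thesis
    using px[OF assms(2)] py[OF assms(2)] row_exp_bound(2)[OF assms(1)]
    by (simp add: cell_def cells_def div_less_iff_less_mult mult.commute del: power_Suc power_Suc2)
qed

lemma finite_cells: "finite (cells a)"
  by (simp add: cells_def)

lemma pairing_haar:
  assumes "a < M"
  shows "pairing (haar a) = (\<Sum>c\<in>cells a. \<bar>weight a c\<bar>)"
proof -
  have "pairing (haar a) = (\<Sum>e\<in>E. \<chi> e * (sgn (weight a (cell a e)) * ramp (3*a) (px e) * ramp (row_exp a) (py e)))"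
  proof -
    have "haar a = (\<lambda>X Y. sgn (weight a (X div 2^(3*a+2), Y div 2^(row_exp a + 2))) * qstep (3*a) X * qstep (row_exp a) Y)"
      by (intro ext) (rule haar_def)
    then show ?thesis
      unfolding cell_def using levels[OF assms] row_exp_bound(1)[OF assms]
      by (simp only:) (rule pairing_qstep, auto)
  qed
  also have "\<dots> = (\<Sum>c\<in>cells a. \<Sum>e | e \<in> E \<and> cell a e = c.
        \<chi> e * (sgn (weight a (cell a e)) * ramp (3*a) (px e) * ramp (row_exp a) (py e)))"
    using cell_in_cells[OF assms] finite_E 
    by (intro sum.group[symmetric]) (auto simp: finite_cells)
  also have "\<dots> = (\<Sum>c\<in>cells a. sgn (weight a c) * weight a c)"
    unfolding weight_def[of a] sum_distrib_left by (intro sum.cong refl) (auto simp: mult_ac)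
  also have "\<dots> = (\<Sum>c\<in>cells a. \<bar>weight a c\<bar>)"
    by (simp add: abs_sgn mult.commute)
  finally show ?thesis .
qed

lemma haar_round_down:
  assumes "a < M" "m \<le> 3 * a" "m' \<le> row_exp a"
  shows "haar a (X div 2^m * 2^m) (Y div 2^m' * 2^m') = haar a X Y"
  using assms by (simp add: haar_def qstep_round_down div_round_down del: power_Suc power_Suc2 add_2_eq_Suc')

text \<open>For \<open>l < a\<close> the factor \<open>haar l\<close> is constant in
  \<open>Y\<close> on the row blocks of level \<open>a\<close>, where \<open>haar a\<close> has mean
  zero. Hence the Riesz product has the same mass as the constant 1.\<close>

lemma sum_haar_mult_prod:
  assumes "a < M"
  shows "(\<Sum>Y<2^k. haar a X Y * (\<Prod>l<a. 1 + \<gamma> * haar l X Y)) = 0"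
proof -
  let ?W = "2 ^ (row_exp a + 2) :: nat"
  have round: "haar l X (Y div ?W * ?W) = haar l X Y" if "l < a" for l Y
    using haar_round_down[of l 0 "row_exp a + 2" X Y] that levels[OF assms] assms by (simp add: row_exp_def)
  define C where "C v = sgn (weight a (X div 2^(3*a+2), v)) * qstep (3*a) X
      * (\<Prod>l<a. 1 + \<gamma> * haar l X (v * ?W))" for v
  have "haar a X Y * (\<Prod>l<a. 1 + \<gamma> * haar l X Y) = C (Y div ?W) * qstep (row_exp a) Y" for Y
    unfolding C_def using round by (simp add: haar_def[of a] del: power_Suc add_2_eq_Suc')
  then show ?thesis using sum_blocks_qstep[OF row_exp_bound(1)[OF assms], of C] by simp
qed

text \<open>The factors between \<open>b\<close> and \<open>a\<close> are constant on the cells of size \<open>2^(3b+2) \<times> 2^(row_exp a + 2)\<close>, on which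
  the product of the two outer factors oscillates; these cells have area \<open>2^k / 8^(a-b)\<close>.\<close>

lemma abs_pairing_interaction_le:
  assumes ab: "b < a" "a < M" and \<gamma>: "0 \<le> \<gamma>" "\<gamma> \<le> 1"
  shows "\<bar>pairing (\<lambda>X Y. haar b X Y * haar a X Y * (\<Prod>l\<in>{b<..<a}. 1 + \<gamma> * haar l X Y))\<bar>
    \<le> real (card E) * 2^k / 32 * (1/4)^(a-b)"
proof -
  let ?W = "2 ^ (3*b + 2) :: nat" and ?H = "2 ^ (row_exp a + 2) :: nat"
  \<comment> \<open>\<open>rx u\<close> and \<open>ry v\<close> are the corners of the blocks.
    Evaluating there every factor that is constant on the blocks gives the coefficient
    \<open>C\<close> that \<open>pairing_qstep\<close> asks for.\<close>
  define rx where "rx u = u * ?W" for u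
  define ry where "ry v = v * ?H" for v
  define C where "C u v = sgn (weight b (u, ry v div 2^(row_exp b + 2))) * qstep (row_exp b) (ry v)
     * (sgn (weight a (rx u div 2^(3*a+2), v)) * qstep (3*a) (rx u))
     * (\<Prod>l\<in>{b<..<a}. 1 + \<gamma> * haar l (rx u) (ry v))" for u v
  have k: "3 * a + 4 \<le> k" using levels ab by simp
  have "haar l (rx (X div ?W)) (ry (Y div ?H)) = haar l X Y" if "l \<in> {b<..<a}" for l X Y
    unfolding rx_def ry_def using that ab k by (intro haar_round_down) (auto simp: row_exp_def)
  moreover have "qstep (row_exp b) (ry (Y div ?H)) = qstep (row_exp b) Y" "qstep (3*a) (rx (X div ?W)) = qstep (3*a) X"
    "ry (Y div ?H) div 2^(row_exp b + 2) = Y div 2^(row_exp b + 2)"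
    "rx (X div ?W) div 2^(3*a+2) = X div 2^(3*a+2)" for X Y
    unfolding rx_def ry_def using ab k
    by (intro qstep_round_down div_round_down; simp add: row_exp_def)+
  ultimately have "haar b X Y * haar a X Y * (\<Prod>l\<in>{b<..<a}. 1 + \<gamma> * haar l X Y)
     = C (X div ?W) (Y div ?H) * qstep (3*b) X * qstep (row_exp a) Y" for X Y
    unfolding C_def by (simp add: haar_def[of a] haar_def[of b] mult_ac del: power_Suc add_2_eq_Suc')
  then have eq: "pairing (\<lambda>X Y. haar b X Y * haar a X Y * (\<Prod>l\<in>{b<..<a}. 1 + \<gamma> * haar l X Y))
     = (\<Sum>e\<in>E. \<chi> e * (C (px e div ?W) (py e div ?H) * ramp (3*b) (px e) * ramp (row_exp a) (py e)))"
    using pairing_qstep[of "3*b" "row_exp a" C] ab k row_exp_bound(1)[of a] by simp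
  have "\<bar>\<Sum>e\<in>E. \<chi> e * (C (px e div ?W) (py e div ?H) * ramp (3*b) (px e) * ramp (row_exp a) (py e))\<bar>
     \<le> (\<Sum>e\<in>E. 2^k / 32 * (1/4)^(a-b))"
  proof (rule order.trans[OF sum_abs], rule sum_mono)
    fix e assume e: "e \<in> E"
    have P: "\<bar>\<Prod>l\<in>{b<..<a}. 1 + \<gamma> * haar l X Y\<bar> \<le> 2 ^ (a - Suc b)" for X Y
    proof -
      have "\<bar>\<Prod>l\<in>{b<..<a}. 1 + \<gamma> * haar l X Y\<bar> \<le> (\<Prod>l\<in>{b<..<a}. 2)"
        unfolding abs_prod
      proof (rule prod_mono, safe)
        fix l
        have "\<bar>\<gamma> * haar l X Y\<bar> \<le> 1 * 1" unfolding abs_mult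
          using \<gamma> abs_haar_le by (intro mult_mono) auto
        then show "\<bar>1 + \<gamma> * haar l X Y\<bar> \<le> 2" by linarith
      qed auto
      then show ?thesis by simp
    qed
    have "\<bar>C u v\<bar> \<le> 1 * 1 * (1 * 1) * 2 ^ (a - Suc b)" for u v
      unfolding C_def abs_mult by (intro mult_mono abs_qstep_le P) (auto simp: sgn_if)
    then have C: "\<bar>C u v\<bar> \<le> 2 ^ (a - Suc b)" for u v by simp
    have "\<bar>\<chi> e * (C (px e div ?W) (py e div ?H) * ramp (3*b) (px e) * ramp (row_exp a) (py e))\<bar>
       \<le> 1 * (2 ^ (a - Suc b) * 2 ^ (3*b) * 2 ^ row_exp a)"
      unfolding abs_mult using \<chi>[OF e] ramp_nonneg ramp_le
      by (intro mult_mono C) auto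
    \<comment> \<open>The ramps contribute \<open>2^(k-4) / 8^(a-b)\<close> and the factors in
      between at most \<open>2^(a-b-1)\<close>, which leaves 1/4 per level.\<close>
    also have "\<dots> = 2^k / 32 * (1/4)^(a-b)"
    proof -
      obtain d where d: "a = b + Suc d" using ab less_iff_Suc_add by auto
      obtain k' where k': "k = 3 * a + 4 + k'" using k le_Suc_ex by blast
      have "(2::real)^k = 128 * 2^(3*b) * 2^d * 4^d * 2^k'"
        unfolding d k' by (simp add: power_add power_mult flip: power_mult_distrib)
      moreover have "row_exp a = k'" unfolding row_exp_def using k' by simp
      ultimately show ?thesis by (simp add: d power_divide)
    qed
    finally show "\<bar>\<chi> e * (C (px e div ?W) (py e div ?H) * ramp (3*b) (px e) * ramp (row_exp a) (py e))\<bar>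
       \<le> 2^k / 32 * (1/4)^(a-b)" .
  qed
  then show ?thesis unfolding eq by simp
qed

lemma pairing_sum: "pairing (\<lambda>X Y. \<Sum>i\<in>I. F i X Y) = (\<Sum>i\<in>I. pairing (F i))"
proof -
  have "pairing (\<lambda>X Y. \<Sum>i\<in>I. F i X Y) = (\<Sum>X<2^k. \<Sum>i\<in>I. \<Sum>Y<2^k. D X Y * F i X Y)"
    unfolding pairing_def sum_distrib_left by (intro sum.cong refl sum.swap)
  also have "\<dots> = (\<Sum>i\<in>I. pairing (F i))"
    unfolding pairing_def by (rule sum.swap)
  finally show ?thesis .
qed

lemma pairing_add: "pairing (\<lambda>X Y. F X Y + G X Y) = pairing F + pairing G"
  by (simp add: pairing_def distrib_left sum.distrib)

lemma pairing_cmult: "pairing (\<lambda>X Y. c * F X Y) = c * pairing F"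
  by (simp add: pairing_def sum_distrib_left mult_ac)

text \<open>With \<open>R\<close> the Riesz product, \<open>D\<close> is paired with
  \<open>R - 1\<close>. From above, \<bar>R - 1\<bar> is at most \<open>R + 1\<close>, of mass
  \<open>2 * (2^k)^2\<close>; from below, the linear terms give the weights and the interactions sum
  to a geometric series.\<close>

lemma sum_abs_weight_le:
  assumes \<gamma>: "0 < \<gamma>" "\<gamma> \<le> 1"
    and \<Delta>: "\<And>X Y. X < 2^k \<Longrightarrow> Y < 2^k \<Longrightarrow> \<bar>D X Y\<bar> \<le> \<Delta>"
  shows "\<gamma> * (\<Sum>a<M. \<Sum>c\<in>cells a. \<bar>weight a c\<bar>)
    \<le> 2 * (2^k)\<^sup>2 * \<Delta> + \<gamma>\<^sup>2 * (real M * real (card E) * 2^k / 96)"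
proof -
  define R where "R X Y = (\<Prod>a<M. 1 + \<gamma> * haar a X Y)" for X Y
  define T where "T b a X Y = haar b X Y * haar a X Y * (\<Prod>l\<in>{b<..<a}. 1 + \<gamma> * haar l X Y)" for b a X Y
  have R_nonneg: "0 \<le> R X Y" for X Y
    unfolding R_def
  proof (rule prod_nonneg, safe)
    fix a
    have "\<bar>\<gamma> * haar a X Y\<bar> \<le> 1 * 1" unfolding abs_mult
      using \<gamma> abs_haar_le by (intro mult_mono) auto
    then show "0 \<le> 1 + \<gamma> * haar a X Y" by linarith
  qed
  have R_tel: "R X Y = 1 + (\<Sum>a<M. \<gamma> * (haar a X Y * (\<Prod>l<a. 1 + \<gamma> * haar l X Y)))" for X Y
    unfolding R_def by (subst prod_one_plus_telescope) (simp add: mult_ac)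
  have "(\<Sum>X<2^k. \<Sum>Y<2^k. R X Y) = (\<Sum>X<2^k. 2^k + (\<Sum>a<M. \<gamma> * (\<Sum>Y<2^k. haar a X Y * (\<Prod>l<a. 1 + \<gamma> * haar l X Y))))"
    unfolding R_tel sum.distrib sum_distrib_left by (subst sum.swap) simp
  also have "\<dots> = (2^k)\<^sup>2"
    by (simp add: sum_haar_mult_prod power2_eq_square)
  finally have sum_R: "(\<Sum>X<2^k. \<Sum>Y<2^k. R X Y) = (2^k)\<^sup>2" .
  have "R X Y - 1 = (\<Sum>a<M. \<gamma> * haar a X Y) + (\<Sum>a<M. \<gamma>\<^sup>2 * (\<Sum>b<a. T b a X Y))" for X Y
    unfolding R_tel prod_one_plus_telescope_rev T_def
    by (simp add: sum_distrib_left sum.distrib algebra_simps power2_eq_square)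
  then have pR: "pairing (\<lambda>X Y. R X Y - 1)
     = \<gamma> * (\<Sum>a<M. pairing (haar a)) + \<gamma>\<^sup>2 * (\<Sum>a<M. \<Sum>b<a. pairing (T b a))"
    by (simp add: pairing_add pairing_sum pairing_cmult flip: sum_distrib_left)
  have "pairing (\<lambda>X Y. R X Y - 1) \<le> (\<Sum>X<2^k. \<Sum>Y<2^k. \<Delta> * (R X Y + 1))"
    unfolding pairing_def
  proof (intro sum_mono)
    fix X Y :: nat assume XY: "X \<in> {..<2^k}" "Y \<in> {..<2^k}"
    have "D X Y * (R X Y - 1) \<le> \<bar>D X Y\<bar> * \<bar>R X Y - 1\<bar>" by (metis abs_ge_self abs_mult)
    also have "\<dots> \<le> \<Delta> * (R X Y + 1)"
      using \<Delta>[of X Y] XY R_nonneg[of X Y] by (intro mult_mono) auto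
    finally show "D X Y * (R X Y - 1) \<le> \<Delta> * (R X Y + 1)" .
  qed
  also have "\<dots> = \<Delta> * ((\<Sum>X<2^k. \<Sum>Y<2^k. R X Y) + (2^k)\<^sup>2)"
    by (simp add: sum.distrib power2_eq_square distrib_left flip: sum_distrib_left)
  finally have upper: "pairing (\<lambda>X Y. R X Y - 1) \<le> 2 * (2^k)\<^sup>2 * \<Delta>"
    by (simp add: sum_R mult.commute)
  have "\<bar>\<Sum>a<M. \<Sum>b<a. pairing (T b a)\<bar> \<le> (\<Sum>a<M. \<Sum>b<a. real (card E) * 2^k / 32 * (1/4)^(a-b))"
    unfolding T_def using \<gamma>
    by (intro order.trans[OF sum_abs] sum_mono abs_pairing_interaction_le) auto
  also have "\<dots> \<le> (\<Sum>a<M. real (card E) * 2^k / 32 * (1/3))"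
    unfolding sum_distrib_left[symmetric]
    by (intro sum_mono mult_left_mono sum_quarter_powers_le) auto
  finally have "\<gamma>\<^sup>2 * - (\<Sum>a<M. \<Sum>b<a. pairing (T b a)) \<le> \<gamma>\<^sup>2 * (real M * real (card E) * 2^k / 96)"
    by (intro mult_left_mono) (auto simp: mult_ac)
  then show ?thesis using pR upper by (simp add: pairing_haar)
qed

end

section \<open>Codes and digital nets\<close>

lemma sum_Pow_inverse_two_power_card:
  assumes "finite I"
  shows "(\<Sum>T\<in>Pow I. (1/2::real) ^ card T) = (3/2) ^ card I"
  using assms
proof induction
  case (insert x I)
  have "(\<Sum>T\<in>Pow (insert x I). (1/2::real) ^ card T)
      = (\<Sum>T\<in>Pow I. (1/2) ^ card T) + (\<Sum>T\<in>insert x ` Pow I. (1/2) ^ card T)"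
    unfolding Pow_insert using insert by (intro sum.union_disjoint) auto
  also have "(\<Sum>T\<in>insert x ` Pow I. (1/2::real) ^ card T) = (\<Sum>T\<in>Pow I. (1/2) ^ card (insert x T))"
    using insert by (intro sum.reindex_cong[where l="insert x"]) (auto simp: inj_on_def insert_ident subset_iff)
  also have "\<dots> = (\<Sum>T\<in>Pow I. (1/2) * (1/2) ^ card T)"
    using insert by (intro sum.cong refl) (auto simp: card_insert_if finite_subset)
  also have "\<dots> = (1/2) * (3/2) ^ card I"
    using insert by (simp only: sum_distrib_left[symmetric])
  finally show ?case using insert by simp
qed simp

lemma three_halves_le: "(3/2::real) \<le> 2 powr (5/8)"
proof -
  have "(2 powr (5/8::real)) ^ 8 = 2 powr 5"
    by (simp add: powr_powr flip: powr_realpow)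
  then have "(3/2::real) ^ 8 \<le> (2 powr (5/8)) ^ 8" by (simp add: power_divide)
  then show ?thesis using power_mono_iff[of "3/2" "2 powr (5/8::real)" 8] by simp
qed

text \<open>Weigh \<open>B\<close> by \<open>(1/2)^d\<close>, where \<open>d\<close> is its distance
  from \<open>A\<close>, and let \<open>N = card I\<close>. Members of the ball weigh at least
  \<open>2^(-N/8)\<close>, all sets together \<open>(3/2)^N <= 2^(5N/8)\<close>, and 5/8 + 1/8 =
  3/4.\<close>

lemma card_hamming_ball_le:
  assumes I: "finite I" and A: "A \<subseteq> I"
  shows "real (card {B \<in> Pow I. 8 * card (sym_diff A B) \<le> card I}) \<le> 2 powr (3/4 * real (card I))"
proof -
  let ?N = "card I" and ?U = "{B \<in> Pow I. 8 * card (sym_diff A B) \<le> card I}"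
  have "real (card ?U) * 2 powr (- real ?N / 8) = (\<Sum>B\<in>?U. 2 powr (- real ?N / 8))" by simp
  also have "\<dots> \<le> (\<Sum>B\<in>?U. (1/2) ^ card (sym_diff A B))"
  proof (rule sum_mono)
    fix B assume "B \<in> ?U"
    then have "- real ?N / 8 \<le> - real (card (sym_diff A B))" by simp
    then have "2 powr (- real ?N / 8) \<le> 2 powr (- real (card (sym_diff A B)))" by simp
    also have "\<dots> = (1/2) ^ card (sym_diff A B)" 
      by (simp add: powr_minus powr_realpow power_one_over inverse_eq_divide)
    finally show "2 powr (- real ?N / 8) \<le> (1/2) ^ card (sym_diff A B)" .
  qed
  also have "\<dots> \<le> (\<Sum>B\<in>Pow I. (1/2) ^ card (sym_diff A B))"
    using I by (intro sum_mono2) auto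
  also have "\<dots> = (\<Sum>T\<in>Pow I. (1/2) ^ card T)"
    using A by (intro sum.reindex_bij_witness[where i="sym_diff A" and j="sym_diff A"]) auto
  also have "\<dots> = (3/2) ^ ?N" using I by (rule sum_Pow_inverse_two_power_card)
  also have "\<dots> \<le> (2 powr (5/8)) ^ ?N" by (intro power_mono three_halves_le) auto
  also have "\<dots> = 2 powr (5/8 * real ?N)" by (simp add: powr_powr flip: powr_realpow)
  finally have "real (card ?U) \<le> 2 powr (5/8 * real ?N) / 2 powr (- real ?N / 8)"
    by (simp add: pos_le_divide_eq)
  also have "\<dots> = 2 powr (5/8 * real ?N - (- real ?N / 8))" by (rule powr_diff[symmetric])
  also have "5/8 * real ?N - (- real ?N / 8) = 3/4 * real ?N" by simp
  finally show ?thesis .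
qed

text \<open>The balls around a maximal separated family cover the power set, and each holds at most
  \<open>2^(3N/4)\<close> of its \<open>2^N\<close> members, where
  \<open>N = card I\<close>.\<close>

lemma gilbert_varshamov:
  fixes I :: "'a set"
  assumes I: "finite I"
  obtains F where "F \<subseteq> Pow I" "2 powr (real (card I) / 4) \<le> real (card F)"
    "\<And>A B. A \<in> F \<Longrightarrow> B \<in> F \<Longrightarrow> A \<noteq> B \<Longrightarrow> card I < 8 * card (sym_diff A B)"
proof -
  let ?N = "card I"
  define sep where "sep F \<longleftrightarrow> (\<forall>A\<in>F. \<forall>B\<in>F. A \<noteq> B \<longrightarrow> ?N < 8 * card (sym_diff A B))" for F :: "'a set set"
  have "finite {F \<in> Pow (Pow I). sep F}" using I by simp
  moreover have "{} \<in> {F \<in> Pow (Pow I). sep F}" by (simp add: sep_def)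
  ultimately obtain F where F: "F \<subseteq> Pow I" "sep F"
    and max: "\<And>G. G \<subseteq> Pow I \<Longrightarrow> sep G \<Longrightarrow> F \<subseteq> G \<Longrightarrow> F = G"
    using finite_has_maximal[of "{F \<in> Pow (Pow I). sep F}"] by (metis (no_types, lifting) Pow_iff empty_iff mem_Collect_eq)
  define U where "U A = {B \<in> Pow I. 8 * card (sym_diff A B) \<le> ?N}" for A
  have finF: "finite F" using F(1) I by (meson finite_Pow_iff finite_subset)
  have "Pow I \<subseteq> (\<Union>A\<in>F. U A)"
  proof
    fix B assume B: "B \<in> Pow I"
    show "B \<in> (\<Union>A\<in>F. U A)"
    proof (rule ccontr)
      assume notin: "B \<notin> (\<Union>A\<in>F. U A)"
      then have far: "?N < 8 * card (sym_diff A B)" if "A \<in> F" for A using that B by (auto simp: U_def not_le)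
      then have "sep (insert B F)" using F(2) by (auto simp: sep_def Un_commute)
      then have "B \<in> F" using max[of "insert B F"] B F(1) by auto
      \<comment> \<open>\<open>far\<close> would put \<open>B\<close> at positive distance from
        itself.\<close>
      then show False using far by fastforce
    qed
  qed
  then have "card (Pow I) \<le> card (\<Union>A\<in>F. U A)"
    using finF I by (intro card_mono) (auto simp: U_def)
  also have "\<dots> \<le> (\<Sum>A\<in>F. card (U A))" using finF by (rule card_UN_le)
  finally have "real (card (Pow I)) \<le> (\<Sum>A\<in>F. real (card (U A)))"
    by (metis of_nat_le_iff of_nat_sum)
  also have "\<dots> \<le> (\<Sum>A\<in>F. 2 powr (3/4 * real ?N))"
    unfolding U_def using F(1) I by (intro sum_mono card_hamming_ball_le) auto
  finally have "2 powr (real ?N) \<le> real (card F) * 2 powr (3/4 * real ?N)"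
    using I by (simp add: card_Pow powr_realpow)
  then have "2 powr (real ?N) / 2 powr (3/4 * real ?N) \<le> real (card F)"
    by (simp add: pos_divide_le_eq)
  also have "2 powr (real ?N) / 2 powr (3/4 * real ?N) = 2 powr (real ?N / 4)"
    by (simp add: powr_diff[symmetric])
  finally show ?thesis using that F by (auto simp: sep_def)
qed

section \<open>Digital nets with flipped digits\<close>

text \<open>The leading \<open>i\<close> binary digits of the ordinate that the net of \<open>S\<close> assigns to the abscissa \<open>x\<close>.
  A triple \<open>(i, u, v)\<close> in \<open>S\<close> stands for the cell of abscissas with \<open>x div 2^(i+1) = u\<close> and ordinates with
  leading digits \<open>v\<close>; the next digit of the ordinate is digit \<open>i\<close> of \<open>x\<close>, flipped in such a cell.\<close>

primrec top_bits :: "(nat \<times> nat \<times> nat) set \<Rightarrow> nat \<Rightarrow> nat \<Rightarrow> nat" where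
  "top_bits S 0 x = 0"
| "top_bits S (Suc i) x = 2 * top_bits S i x + (x div 2^i + of_bool ((i, x div 2^(Suc i), top_bits S i x) \<in> S)) mod 2"

lemma top_bits_less: "top_bits S i x < 2 ^ i"
proof (induction i)
  case (Suc i)
  have "(x div 2^i + of_bool ((i, x div 2^(Suc i), top_bits S i x) \<in> S)) mod 2 < (2::nat)" by simp
  with Suc show ?case unfolding top_bits.simps power_Suc by linarith
qed simp

lemma top_bits_div:
  assumes "j \<le> i"
  shows "top_bits S i x div 2^(i-j) = top_bits S j x"
  using assms
proof (induction rule: dec_induct)
  case (step i)
  then have "top_bits S (Suc i) x div 2^(Suc i - j) = top_bits S (Suc i) x div 2 div 2^(i-j)"
    by (simp add: Suc_diff_le div_mult2_eq)
  also have "top_bits S (Suc i) x div 2 = top_bits S i x" by simp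
  finally show ?case using step by simp
qed simp

lemma top_bits_Suc_no_flip:
  assumes "\<And>u v. (i, u, v) \<notin> S"
  shows "top_bits S (Suc i) x = 2 * top_bits S i x + x div 2^i mod 2"
  using assms by simp

text \<open>The net property: each dyadic cell of area \<open>2^k\<close> holds one point, whatever
  the flips. In the induction the last digit of \<open>v\<close> and the flip determine digit
  \<open>i\<close> of \<open>x\<close>, which leads to a cell of half the width and twice the
  height.\<close>

lemma top_bits_ex1:
  assumes "i \<le> k" "u < 2^(k-i)" "v < 2^i"
  shows "\<exists>!x. x < 2^k \<and> x div 2^i = u \<and> top_bits S i x = v"
  using assms
proof (induction i arbitrary: u v)
  case 0
  then show ?case by auto
next
  case (Suc i)
  \<comment> \<open>\<beta> is the flip in force in this cell; the last digit of \<open>u'\<close>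
    is the value that digit \<open>i\<close> of \<open>x\<close> must then have.\<close>
  define \<beta> :: nat where "\<beta> = of_bool ((i, u, v div 2) \<in> S)"
  define u' where "u' = 2 * u + (v mod 2 + \<beta>) mod 2"
  have "2^(k-i) = 2 * (2::nat)^(k - Suc i)"
    using Suc.prems by (simp add: Suc_diff_Suc flip: power_Suc)
  then have "u' < 2^(k-i)" using Suc.prems unfolding u'_def by linarith
  moreover have "v div 2 < 2^i" using Suc.prems by simp
  ultimately have ex: "\<exists>!x. x < 2^k \<and> x div 2^i = u' \<and> top_bits S i x = v div 2"
    using Suc.IH Suc.prems by simp
  have "x div 2^Suc i = u \<and> top_bits S (Suc i) x = v \<longleftrightarrow> x div 2^i = u' \<and> top_bits S i x = v div 2" for x
  proof -
    have d: "x div 2^Suc i = x div 2^i div 2" by (metis div_mult2_eq power_Suc2)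
    have split2: "c div 2 = e \<and> c mod 2 = b mod 2 \<longleftrightarrow> c = 2 * e + b mod 2" for b c e :: nat
      using mult_div_mod_eq[of 2 c] by (metis div_mult_self4 mod_div_trivial mod_mod_trivial mod_mult_self4 add_0_right zero_neq_numeral)
    have parity: "(c + b) mod 2 = e mod 2 \<longleftrightarrow> c mod 2 = (e mod 2 + b) mod 2" for b c e :: nat
      by (auto simp: mod_2_eq_odd)
    have "m div 2 = u \<and> 2 * t + (m + b) mod 2 = v \<longleftrightarrow> m = u' \<and> t = v div 2"
      if b: "m div 2 = u \<Longrightarrow> t = v div 2 \<Longrightarrow> b = \<beta>" for m t b :: nat
    proof -
      have "2 * t + (m + b) mod 2 = v \<longleftrightarrow> t = v div 2 \<and> (m + b) mod 2 = v mod 2"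
        using split2[of v t "m + b"] by auto
      also have "m div 2 = u \<and> \<dots> \<longleftrightarrow> m div 2 = u \<and> t = v div 2 \<and> m mod 2 = (v mod 2 + \<beta>) mod 2"
        using b by (auto simp: parity)
      also have "\<dots> \<longleftrightarrow> m = u' \<and> t = v div 2"
        unfolding u'_def using split2[of m u "v mod 2 + \<beta>"] by blast
      finally show ?thesis .
    qed
    then show ?thesis unfolding top_bits.simps d by (simp add: \<beta>_def)
  qed
  then show ?case using ex by simp
qed

text \<open>With flips only at levels \<open>3a + 2\<close>, the two levels above and the level below a flip are rigid; so in
  the cells selected here the quarter containing the point is known in the horizontal direction, and the
  flip moves it from the second to the fourth quarter (or back) in the vertical one.\<close>

definition flips :: "nat \<Rightarrow> nat \<Rightarrow> (nat \<times> nat \<times> nat) set" where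
  "flips k M = (\<lambda>(a, u, v). (3 * a + 2, 2 * u + 1, 4 * v + 2)) ` (SIGMA a:{..<M}. {..<2^(k-3*a-4)} \<times> {..<2^(3*a)})"

lemma finite_flips: "finite (flips k M)"
  by (simp add: flips_def)

lemma card_flips:
  assumes "\<And>a. a < M \<Longrightarrow> 3 * a + 4 \<le> k"
  shows "card (flips k M) = M * 2^(k-4)"
proof -
  have "card (flips k M) = card (SIGMA a:{..<M}. {..<2^(k-3*a-4)} \<times> {..<2^(3*a)} :: (nat \<times> nat \<times> nat) set)"
    unfolding flips_def by (intro card_image) (auto simp: inj_on_def)
  also have "\<dots> = (\<Sum>a<M. 2^(k-3*a-4) * 2^(3*a))" by (simp add: card_cartesian_product)
  also have "\<dots> = (\<Sum>a<M. 2^(k-4))"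
  proof (rule sum.cong[OF refl])
    fix a assume "a \<in> {..<M}"
    then have "k - 3*a - 4 + 3 * a = k - 4" using assms[of a] by simp
    then show "(2::nat)^(k-3*a-4) * 2^(3*a) = 2^(k-4)" by (simp flip: power_add)
  qed
  finally show ?thesis by simp
qed

lemma flipsE:
  assumes "(i, u, v) \<in> flips k M"
  obtains a where "a < M" "i = 3 * a + 2" "odd u" "v mod 4 = 2" "u div 2 < 2^(k-3*a-4)" "v div 4 < 2^(3*a)"
proof -
  from assms obtain a u' v' where a: "a < M" "i = 3 * a + 2" "u = 2 * u' + 1" "v = 4 * v' + 2"
    "u' < 2^(k-3*a-4)" "v' < 2^(3*a)"
    by (auto simp: flips_def)
  then have "v mod 4 = 2" by presburger
  with a show ?thesis using that by simp
qed

text \<open>The last two digits of \<open>v\<close> are 1 and 0; being unflipped they are digits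
  \<open>3a\<close> and \<open>3a+1\<close> of \<open>x\<close>, which means the second quarter.
  Digit \<open>3a+2\<close> of \<open>x\<close> is 0 because the column is \<open>2 * u\<close>, so
  the next ordinate digit shows the flip alone; the one after it is 1 because \<open>u\<close> is
  odd.\<close>

lemma quarters_of_flip_cell:
  assumes S: "S \<subseteq> flips k M" and x: "x div 2^(3*a+2) = 2 * u" "top_bits S (3*a+2) x = v"
    and uv: "odd u" "v mod 4 = 2"
  shows "(x div 2^(3*a)) mod 4 = 1"
    and "top_bits S (3*a+4) x mod 4 = (if (3*a+2, u, v) \<in> S then 3 else 1)"
proof -
  have nf: "(3*a, p, q) \<notin> S" "(Suc (3*a), p, q) \<notin> S" "(3*a+3, p, q) \<notin> S" for p q
  proof -
    have "i mod 3 = 2" if "(i, p, q) \<in> S" for i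
    proof -
      from that S obtain a' where "i = 3 * a' + 2" by (meson flipsE subsetD)
      then show ?thesis by presburger
    qed
    moreover have "3*a mod 3 \<noteq> 2" "Suc (3*a) mod 3 \<noteq> 2" "(3*a+3) mod 3 \<noteq> 2" by presburger+
    ultimately show "(3*a, p, q) \<notin> S" "(Suc (3*a), p, q) \<notin> S" "(3*a+3, p, q) \<notin> S" by blast+
  qed
  define y where "y = x div 2^(3*a)"
  have y: "x div 2^Suc (3*a) = y div 2" "x div 2^(3*a+2) = y div 4" "x div 2^(3*a+3) = y div 8"
    by (simp_all add: y_def power_add mult.commute flip: div_mult2_eq)
  have quarter: "z mod 4 = 1" if "2 * (2 * t + z mod 2) + z div 2 mod 2 = v" for z t :: nat
  proof -
    have "v = (2 * (z mod 2) + z div 2 mod 2) + 4 * t" using that by simp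
    moreover have lt: "z mod 2 < 2" "z div 2 mod 2 < 2" by simp_all
    ultimately have "2 * (z mod 2) + z div 2 mod 2 = 2" using uv(2) by (simp only: mod_mult_self2) simp
    moreover from this lt have "z mod 2 = 1" by linarith
    ultimately show ?thesis using mod_mult2_eq[of z 2 2] by simp
  qed
  have succs: "3*a + 2 = Suc (Suc (3*a))" "3*a + 4 = Suc (3*a + 3)" "3*a + 3 = Suc (3*a + 2)" by simp_all
  have "2 * (2 * top_bits S (3*a) x + y mod 2) + y div 2 mod 2 = v"
    using x(2) unfolding succs top_bits_Suc_no_flip[OF nf(1)] top_bits_Suc_no_flip[OF nf(2)] y
    by (simp add: y_def)
  then show "(x div 2^(3*a)) mod 4 = 1"
    unfolding y_def by (rule quarter)
  have "top_bits S (3*a+4) x = 2 * top_bits S (3*a+3) x + x div 2^(3*a+3) mod 2"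
    unfolding succs(2) by (rule top_bits_Suc_no_flip[OF nf(3)])
  moreover have "top_bits S (3*a+3) x = 2 * v + (2 * u + of_bool ((3*a+2, x div 2^(3*a+3), v) \<in> S)) mod 2"
    unfolding succs(3) top_bits.simps(2) x by simp
  moreover have "x div 2^(3*a+3) = u"
    using x(1) y by simp
  ultimately have "top_bits S (3*a+4) x = 2 * (2 * v + of_bool ((3*a+2, u, v) \<in> S)) + u mod 2"
    by simp
  then show "top_bits S (3*a+4) x mod 4 = (if (3*a+2, u, v) \<in> S then 3 else 1)"
    using uv(1) by (simp add: odd_iff_mod_2_eq_one mod_simps)
qed

section \<open>Discrepancy of two nets\<close>

text \<open>The grid starts at 1, abscissas and digit strings at 0; hence the shift.\<close>

definition net_point :: "nat \<Rightarrow> (nat \<times> nat \<times> nat) set \<Rightarrow> nat \<Rightarrow> real \<times> real" where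
  "net_point k S x = (real (x + 1), real (top_bits S k x + 1))"

definition net :: "nat \<Rightarrow> (nat \<times> nat \<times> nat) set \<Rightarrow> (real \<times> real) set" where
  "net k S = net_point k S ` {..<2^k}"

lemma inj_net_point: "inj (net_point k S)"
  by (auto simp: inj_def net_point_def)

lemma net_in_grid_point_sets: "net k S \<in> grid_point_sets (2^k)"
proof -
  have "net_point k S x \<in> grid (2^k)" if "x < 2^k" for x
    unfolding grid_def net_point_def using that top_bits_less[of S k x]
    by (intro CollectI exI[of _ "x+1"] exI[of _ "top_bits S k x + 1"]) auto
  then show ?thesis
    by (auto simp: grid_point_sets_def net_def card_image inj_on_subset[OF inj_net_point])
qed

text \<open>The flag \<open>j\<close> tells the second net from the first; a point common to both nets is the copy number 0
  as a point of the first net and the copy number 1 as a point of the second.\<close>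

definition nets_elem :: "nat \<Rightarrow> (nat \<times> nat \<times> nat) set \<Rightarrow> (nat \<times> nat \<times> nat) set
    \<Rightarrow> bool \<times> nat \<Rightarrow> (real \<times> real) \<times> nat" where
  "nets_elem k S1 S2 = (\<lambda>(j, x). if j then (net_point k S2 x, of_bool (net_point k S2 x \<in> net k S1)) else (net_point k S1 x, 0))"

text \<open>All net points have coordinates at least 1, so a rectangle cornered at the origin acts
  as a lower left quadrant. The bounds \<open>X + 1\<close> and \<open>Y + 1\<close> match the shift
  in \<open>net_point\<close>.\<close>

lemma
  shows bij_betw_nets_elem: "bij_betw (nets_elem k S1 S2) (UNIV \<times> {..<2^k}) (mset_elems (mset_set (net k S1) + mset_set (net k S2)))"
    and imbalance_nets: "imbalance (mset_set (net k S1) + mset_set (net k S2)) \<chi> ({0..real X + 1} \<times> {0..real Y + 1})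
      = \<bar>\<Sum>e\<in>UNIV \<times> {..<2^k}. \<chi> (nets_elem k S1 S2 e) * of_bool (snd e \<le> X)
           * of_bool (top_bits (if fst e then S2 else S1) k (snd e) \<le> Y)\<bar>"
proof -
  define \<phi> where "\<phi> = nets_elem k S1 S2"
  note \<phi>_eq = \<phi>_def[unfolded nets_elem_def]
  let ?E = "UNIV \<times> {..<2^k} :: (bool \<times> nat) set"
    and ?X = "mset_set (net k S1) + mset_set (net k S2)"
    and ?R = "{0..real X + 1} \<times> {0..real Y + 1}"
  have fin: "finite (net k S)" for S by (simp add: net_def)
  have count: "count ?X p = of_bool (p \<in> net k S1) + of_bool (p \<in> net k S2)" for p
    using fin by (simp add: count_mset_set')
  have elems: "mset_elems ?X = {(p, i). i < of_bool (p \<in> net k S1) + (of_bool (p \<in> net k S2) :: nat)}"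
    by (simp only: mset_elems_def count)
  have bij: "bij_betw \<phi> ?E (mset_elems ?X)"
    unfolding bij_betw_def
  proof
    show "inj_on \<phi> ?E"
      unfolding inj_on_def \<phi>_eq
      by (auto split: if_splits simp: net_def dest: injD[OF inj_net_point])
        (metis imageI lessThan_iff)+
    show "\<phi> ` ?E = mset_elems ?X"
    proof
      show "\<phi> ` ?E \<subseteq> mset_elems ?X"
        unfolding elems by (auto simp: \<phi>_eq net_def split: if_splits)
      show "mset_elems ?X \<subseteq> \<phi> ` ?E"
      proof
        fix e assume "e \<in> mset_elems ?X"
        then obtain p i where e: "e = (p, i)" "i < of_bool (p \<in> net k S1) + (of_bool (p \<in> net k S2) :: nat)"
          unfolding elems by auto
        then consider (first) "p \<in> net k S1" "i = 0"
          | (second) "p \<in> net k S2" "i = of_bool (p \<in> net k S1)"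
          by (auto simp: of_bool_def split: if_splits) linarith
        then show "e \<in> \<phi> ` ?E"
        proof cases
          case first
          then obtain x where "x < 2^k" "p = net_point k S1 x" by (auto simp: net_def)
          then have "e = \<phi> (False, x)" "(False, x) \<in> ?E" using e first by (auto simp: \<phi>_eq)
          then show ?thesis by blast
        next
          case second
          then obtain x where "x < 2^k" "p = net_point k S2 x" by (auto simp: net_def)
          then have "e = \<phi> (True, x)" "(True, x) \<in> ?E" using e second by (auto simp: \<phi>_eq)
          then show ?thesis by blast
        qed
      qed
    qed
  qed
  have "(\<Sum>e \<in> {e \<in> mset_elems ?X. fst e \<in> ?R}. \<chi> e) = (\<Sum>e \<in> mset_elems ?X. \<chi> e * of_bool (fst e \<in> ?R))"
    by (subst sum.inter_filter, simp, rule sum.cong[OF refl], simp only: of_bool_def split: if_split, simp)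
  also have "\<dots> = (\<Sum>e\<in>?E. \<chi> (\<phi> e) * of_bool (fst (\<phi> e) \<in> ?R))"
    by (rule sum.reindex_bij_betw[OF bij, symmetric])
  also have "\<dots> = (\<Sum>e\<in>?E. \<chi> (\<phi> e) * of_bool (snd e \<le> X) * of_bool (top_bits (if fst e then S2 else S1) k (snd e) \<le> Y))"
    by (intro sum.cong refl) (auto simp: \<phi>_eq net_point_def)
  finally have "imbalance ?X \<chi> ?R = \<bar>\<Sum>e\<in>?E. \<chi> (\<phi> e) * of_bool (snd e \<le> X)
           * of_bool (top_bits (if fst e then S2 else S1) k (snd e) \<le> Y)\<bar>"
    by (simp add: imbalance_def)
  with bij show "bij_betw (nets_elem k S1 S2) ?E (mset_elems ?X)"
    "imbalance ?X \<chi> ?R = \<bar>\<Sum>e\<in>?E. \<chi> (nets_elem k S1 S2 e) * of_bool (snd e \<le> X)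
           * of_bool (top_bits (if fst e then S2 else S1) k (snd e) \<le> Y)\<bar>"
    by (simp_all add: \<phi>_def)
qed

section \<open>Cells in which two nets differ\<close>

lemma flips_bounds:
  assumes "(3 * a + 2, u, v) \<in> flips k M" "3 * a + 4 \<le> k"
  shows "2 * u < 2^(k-(3*a+2))" "v < 2^(3*a+2)"
proof -
  from assms(1) have uv: "odd u" "u div 2 < 2^(k-3*a-4)" "v div 4 < 2^(3*a)"
    by (auto elim!: flipsE)
  have "k-(3*a+2) = 2 + (k-3*a-4)" using assms(2) by simp
  then have "(2::nat)^(k-(3*a+2)) = 4 * 2^(k-3*a-4)" by (simp only: power_add) simp
  then show "2 * u < 2^(k-(3*a+2))" using uv(1,2) by (auto elim!: oddE)
  show "v < 2^(3*a+2)" using uv(3) by (simp add: div_less_iff_less_mult mult.commute)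
qed

text \<open>The vertical ramp is full or zero according to the flip. Where exactly one of two nets
  is flipped, one of the two points in the cell contributes nothing, and no coloring can cancel the
  other.\<close>

lemma ramp_product_flip_cell:
  assumes S: "S \<subseteq> flips k M" and a: "3 * a + 4 \<le> k"
    and x: "x div 2^(3*a+2) = 2 * u" "top_bits S (3*a+2) x = v" and uv: "odd u" "v mod 4 = 2"
  shows "ramp (3*a) x * ramp (k-4-3*a) (top_bits S k x) = (if (3*a+2, u, v) \<in> S then 0 else 2^(k-4))"
proof -
  note q = quarters_of_flip_cell[OF S x uv]
  have "top_bits S k x div 2^(k-4-3*a) = top_bits S (3*a+4) x"
    using top_bits_div[OF a, of S x] by (simp add: add.commute)
  then have "ramp (k-4-3*a) (top_bits S k x) = (if (3*a+2, u, v) \<in> S then 0 else 2^(k-4-3*a))"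
    using q(2) by (auto intro: ramp_second_quarter ramp_fourth_quarter)
  moreover have "ramp (3*a) x = 2^(3*a)" using q(1) by (rule ramp_second_quarter)
  moreover have "(2::real)^(3*a) * 2^(k-4-3*a) = 2^(k-4)" using a by (simp flip: power_add)
  ultimately show ?thesis by simp
qed

lemma disc_nets_ge:
  assumes levels: "\<And>a. a < M \<Longrightarrow> 3 * a + 4 \<le> k"
    and S: "S1 \<subseteq> flips k M" "S2 \<subseteq> flips k M"
    and far: "M * 2^(k-4) \<le> 8 * card (sym_diff S1 S2)" and k: "4 \<le> k"
  shows "real M / 786432 \<le> real_of_int (disc (mset_set (net k S1) + mset_set (net k S2)) axis_rectangles)"
proof -
  let ?X = "mset_set (net k S1) + mset_set (net k S2)"
  have "real M / 786432 \<le> real_of_int (Max (imbalance ?X \<chi> ` axis_rectangles))"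
    if \<chi>: "\<chi> \<in> colorings ?X" for \<chi>
  proof -
    define \<Delta> where "\<Delta> = real_of_int (Max (imbalance ?X \<chi> ` axis_rectangles))"
    define E :: "(bool \<times> nat) set" where "E = UNIV \<times> {..<2^k}"
    define T where "T j = (if j then S2 else S1)" for j
    define py where "py e = top_bits (T (fst e)) k (snd e)" for e
    define c where "c e = real_of_int (\<chi> (nets_elem k S1 S2 e))" for e
    have c: "c e \<in> {-1, 1}" if "e \<in> E" for e
    proof -
      have "nets_elem k S1 S2 e \<in> mset_elems ?X"
        using bij_betw_nets_elem[of k S1 S2] that unfolding E_def by (rule bij_betwE[rule_format])
      then have "\<chi> (nets_elem k S1 S2 e) \<in> {-1, 1}" using \<chi> by (auto simp: colorings_def)
      then show ?thesis by (auto simp: c_def)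
    qed
    interpret signed_points k M E snd py c
      using levels c top_bits_less by unfold_locales (fastforce simp: E_def py_def)+
    have D: "\<bar>D X Y\<bar> \<le> \<Delta>" for X Y
    proof -
      have "{0..real X + 1} \<times> {0..real Y + 1} \<in> axis_rectangles"
        unfolding axis_rectangles_def by (intro CollectI exI conjI, rule refl) auto
      then have "imbalance ?X \<chi> ({0..real X + 1} \<times> {0..real Y + 1}) \<le> Max (imbalance ?X \<chi> ` axis_rectangles)"
        using finite_imbalance_image by (intro Max_ge) auto
      moreover have "\<bar>D X Y\<bar> = real_of_int (imbalance ?X \<chi> ({0..real X + 1} \<times> {0..real Y + 1}))"
        unfolding D_def imbalance_nets unfolding E_def c_def py_def T_def by simp
      ultimately show ?thesis unfolding \<Delta>_def by simp
    qed
    have weight: "\<bar>weight a (2 * u, v)\<bar> = 2^(k-4)" "(2 * u, v) \<in> cells a"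
      if a: "a < M" and uv: "(3*a+2, u, v) \<in> sym_diff S1 S2" for a u v
    proof -
      have uvf: "odd u" "v mod 4 = 2"
        using uv S by (auto elim!: flipsE)
      have "2 * u < 2^(k-(3*a+2))" and v: "v < 2^(3*a+2)"
        using uv S flips_bounds[OF _ levels[OF a]] by blast+
      then have u: "2 * u < 2^(k-3*a-2)" by simp
      show "(2 * u, v) \<in> cells a" using u v unfolding cells_def by blast
      have T: "T j \<subseteq> flips k M" for j using S by (simp add: T_def)
      \<comment> \<open>The cell holds exactly one point of each net, so its weight is a sum of two
        terms.\<close>
      have ex1: "\<exists>!x. x < 2^k \<and> x div 2^(3*a+2) = 2 * u \<and> top_bits (T j) (3*a+2) x = v" for j
        using levels[OF a] u v by (intro top_bits_ex1) (auto simp: diff_diff_eq)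
      then obtain x where x: "\<And>j. x j < 2^k \<and> x j div 2^(3*a+2) = 2 * u \<and> top_bits (T j) (3*a+2) (x j) = v"
        by metis
      have x_eq: "y = x j" if "y < 2^k" "y div 2^(3*a+2) = 2 * u" "top_bits (T j) (3*a+2) y = v" for j y
        using ex1[of j] x[of j] that by metis
      have row_exp2: "row_exp a + 2 = k - (3*a+2)" using levels[OF a] by (simp add: row_exp_def)
      have pydiv: "py (j, y) div 2^(row_exp a + 2) = top_bits (T j) (3*a+2) y" for j y
        unfolding row_exp2 py_def fst_conv snd_conv using levels[OF a] by (intro top_bits_div) simp
      have "{e. e \<in> E \<and> cell a e = (2 * u, v)} = {(False, x False), (True, x True)}"
      proof (rule set_eqI, rule iffI)
        fix e assume "e \<in> {e. e \<in> E \<and> cell a e = (2 * u, v)}"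
        then obtain j y where e: "e = (j, y)" "y < 2^k" and ce: "cell a (j, y) = (2 * u, v)"
          by (auto simp: E_def)
        then have "y = x j" using pydiv[of j y] by (intro x_eq) (simp_all only: cell_def prod.inject snd_conv)
        then show "e \<in> {(False, x False), (True, x True)}" using e by (cases j) auto
      next
        fix e assume "e \<in> {(False, x False), (True, x True)}"
        then obtain j where e: "e = (j, x j)" by auto
        have "cell a e = (2 * u, v)"
          unfolding e cell_def pydiv snd_conv using x[of j] by (simp only: prod.inject)
        then show "e \<in> {e. e \<in> E \<and> cell a e = (2 * u, v)}" using x[of j] e by (auto simp: E_def)
      qed
      then have "weight a (2 * u, v) = (\<Sum>e\<in>{(False, x False), (True, x True)}.
          c e * (ramp (3*a) (snd e) * ramp (row_exp a) (py e)))"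
        unfolding weight_def by (simp only:)
      also have "\<dots> = (\<Sum>e\<in>{(False, x False), (True, x True)}.
          c e * (if (3*a+2, u, v) \<in> T (fst e) then 0 else 2^(k-4)))"
      proof (rule sum.cong[OF refl])
        fix e assume "e \<in> {(False, x False), (True, x True)}"
        then obtain j where e: "e = (j, x j)" by auto
        show "c e * (ramp (3*a) (snd e) * ramp (row_exp a) (py e)) = c e * (if (3*a+2, u, v) \<in> T (fst e) then 0 else 2^(k-4))"
          unfolding e fst_conv snd_conv py_def row_exp_def
          using x[of j] by (intro arg_cong2[where f="(*)"] refl
              ramp_product_flip_cell[OF T levels[OF a] _ _ uvf]) blast+
      qed
      finally have "weight a (2 * u, v) = c (False, x False) * (if (3*a+2, u, v) \<in> S1 then 0 else 2^(k-4))
         + c (True, x True) * (if (3*a+2, u, v) \<in> S2 then 0 else 2^(k-4))"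
        by (simp add: T_def)
      moreover have "c (False, x False) \<in> {-1, 1}" "c (True, x True) \<in> {-1, 1}"
        using c x by (auto simp: E_def)
      ultimately show "\<bar>weight a (2 * u, v)\<bar> = 2^(k-4)" using uv by (auto split: if_splits)
    qed
    \<comment> \<open>\<open>h\<close> sends a flip to its level and test cell:
      \<open>i = 3a+2\<close> gives \<open>i div 3 = a\<close>, and \<open>2 * u\<close> is the left
      half of column block \<open>u\<close>. Distinct flips use distinct cells.\<close>
    define h where "h = (\<lambda>(i::nat, u::nat, v::nat). (i div 3, (2 * u, v)))"
    have h_eq: "h (3 * a + 2, u, v) = (a, (2 * u, v))" for a u v
      by (simp add: h_def)
    let ?G = "sym_diff S1 S2"
    have G: "?G \<subseteq> flips k M" using S by blast
    have "inj_on h ?G"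
    proof (rule inj_on_subset[OF _ G], rule inj_onI)
      fix g g' assume g: "g \<in> flips k M" "g' \<in> flips k M" "h g = h g'"
      obtain i u v i' u' v' where "g = (i, u, v)" "g' = (i', u', v')" by (cases g, cases g') auto
      with g show "g = g'" by (auto simp: h_def elim!: flipsE)
    qed
    have "real (card ?G) * 2^(k-4) = (\<Sum>g\<in>?G. \<bar>weight (fst (h g)) (snd (h g))\<bar>)"
    proof -
      have "\<bar>weight (fst (h g)) (snd (h g))\<bar> = 2^(k-4)" if "g \<in> ?G" for g
      proof -
        obtain i u v where g: "g = (i, u, v)" by (cases g) auto
        with that G obtain a where "a < M" "i = 3 * a + 2" by (meson flipsE subsetD)
        then show ?thesis using weight(1)[of a u v] that unfolding g by (simp only: h_eq fst_conv snd_conv)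
      qed
      then show ?thesis by simp
    qed
    also have "\<dots> = (\<Sum>p\<in>h ` ?G. \<bar>weight (fst p) (snd p)\<bar>)"
      using \<open>inj_on h ?G\<close> by (simp add: sum.reindex)
    also have "\<dots> \<le> (\<Sum>p\<in>(SIGMA a:{..<M}. cells a). \<bar>weight (fst p) (snd p)\<bar>)"
    proof (rule sum_mono2)
      show "h ` ?G \<subseteq> (SIGMA a:{..<M}. cells a)"
      proof (rule image_subsetI, rule prod_cases3)
        fix g i u v assume "g \<in> ?G" and g_eq: "g = (i, u, v)"
        then have g: "(i, u, v) \<in> ?G" by blast
        with G obtain a where "a < M" "i = 3 * a + 2" by (meson flipsE subsetD)
        then show "h g \<in> (SIGMA a:{..<M}. cells a)" unfolding g_eq
          using weight(2)[of a u v] g by (simp only: h_eq) blast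
      qed
    qed (auto intro: finite_cells)
    also have "\<dots> = (\<Sum>a<M. \<Sum>c\<in>cells a. \<bar>weight a c\<bar>)"
      by (subst sum.Sigma) (auto simp: finite_cells case_prod_beta)
    finally have "real (card ?G) * 2^(k-4) \<le> (\<Sum>a<M. \<Sum>c\<in>cells a. \<bar>weight a c\<bar>)" .
    \<comment> \<open>Here \<gamma> = 1/64. With \<open>n = 2^k\<close> the gain is at least
      \<open>M n^2 / 131072\<close>, and the interactions cost at most
      \<open>M n^2 / 196608\<close>, two thirds of that. The difference
      \<open>M n^2 / 393216\<close> is compared with \<open>2 n^2\<close> times \<Delta>, whence
      786432.\<close>
    then have "1/64 * (real (card ?G) * 2^(k-4)) \<le> 1/64 * (\<Sum>a<M. \<Sum>c\<in>cells a. \<bar>weight a c\<bar>)"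
      by simp
    also have "\<dots> \<le> 2 * (2^k)\<^sup>2 * \<Delta> + (1/64)\<^sup>2 * (real M * real (card E) * 2^k / 96)"
      using D by (intro sum_abs_weight_le) auto
    finally have main: "1/64 * (real (card ?G) * 2^(k-4))
       \<le> 2 * (2^k)\<^sup>2 * \<Delta> + (1/64)\<^sup>2 * (real M * real (card E) * 2^k / 96)" .
    define n :: real where "n = 2^k"
    have n: "n > 0" by (simp add: n_def)
    have "(2::real)^4 * 2^(k-4) = n" unfolding n_def power_add[symmetric] using k by simp
    then have n16: "(2::real)^(k-4) = n / 16" by simp
    have "real (M * 2^(k-4)) \<le> real (8 * card ?G)" using far by (simp only: of_nat_le_iff)
    then have G8: "real M * (n / 16) / 8 \<le> real (card ?G)" by (simp add: n16)
    have cE: "real (card E) = 2 * n" by (simp add: E_def card_cartesian_product n_def)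
    have "1/64 * (real M * (n / 16) / 8 * (n / 16)) \<le> 1/64 * (real (card ?G) * (n / 16))"
      using G8 n by (intro mult_left_mono mult_right_mono) auto
    then have "1/64 * (real M * (n / 16) / 8 * (n / 16)) \<le> 2 * n\<^sup>2 * \<Delta> + (1/64)\<^sup>2 * (real M * (2 * n) * n / 96)"
      using main unfolding n16 cE n_def[symmetric] by linarith
    then have "n\<^sup>2 * (real M / 131072) \<le> n\<^sup>2 * (2 * \<Delta> + real M / 196608)"
      by (simp add: power2_eq_square algebra_simps)
    then have "real M / 131072 \<le> 2 * \<Delta> + real M / 196608"
      using n by (simp only: mult_le_cancel_left_pos zero_less_power)
    then show ?thesis unfolding \<Delta>_def[symmetric] by simp
  qed
  moreover have "disc ?X axis_rectangles \<in> (\<lambda>\<chi>. Max (imbalance ?X \<chi> ` axis_rectangles)) ` colorings ?X"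
    unfolding disc_def using finite_colorings colorings_nonempty by (intro Min_in) auto
  ultimately show ?thesis by auto
qed

text \<open>Carries the size of the code over to the collection of nets. A flip can be read off the
  net point in its cell: equal nets give that abscissa the same ordinate, hence the same leading
  digits at every level.\<close>

lemma inj_on_net:
  assumes levels: "\<And>a. a < M \<Longrightarrow> 3 * a + 4 \<le> k"
  shows "inj_on (net k) (Pow (flips k M))"
proof (rule inj_onI)
  have sub: "S1 \<subseteq> S2" if S: "S1 \<subseteq> flips k M" and eq: "net k S1 = net k S2" for S1 S2
  proof
    fix g assume g: "g \<in> S1"
    obtain i u v where guv: "g = (i, u, v)" by (cases g) auto
    with g S obtain a where a: "a < M" "i = 3 * a + 2" by (meson flipsE subsetD)
    have b: "2 * u < 2^(k-i)" "v < 2^i"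
      using flips_bounds[of a u v k M] levels[OF a(1)] a g guv S by auto
    have ik: "Suc i \<le> k" using levels[OF a(1)] a by simp
    obtain x where x: "x < 2^k" "x div 2^i = 2 * u" "top_bits S1 i x = v"
      using top_bits_ex1[of i k "2 * u" v S1] b ik by auto
    have "net_point k S1 x \<in> net k S2" using x(1) eq by (auto simp: net_def)
    then have "top_bits S1 k x = top_bits S2 k x" by (auto simp: net_def net_point_def)
    then have top_bits_eq: "top_bits S1 j x = top_bits S2 j x" if "j \<le> k" for j
      using top_bits_div[OF that] by metis
    have "x div 2^Suc i = u" using x(2) by (metis div_mult2_eq nonzero_mult_div_cancel_left power_Suc2 zero_neq_numeral)
    moreover have "top_bits S2 i x = v" using top_bits_eq[of i] x(3) ik by simp
    ultimately have "(i, u, v) \<in> S1 \<longleftrightarrow> (i, u, v) \<in> S2"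
      using top_bits_eq[OF ik] x unfolding top_bits.simps by (auto simp: of_bool_def split: if_splits)
    then show "g \<in> S2" using g guv by simp
  qed
  show "S1 = S2" if "S1 \<in> Pow (flips k M)" "S2 \<in> Pow (flips k M)" "net k S1 = net k S2" for S1 S2
    using sub that by (metis PowD subset_antisym)
qed

theorem theorem2:
  "\<exists>c c'' :: real. c > 0 \<and> c'' > 0 \<and>
     (\<exists>N :: nat. \<forall>n \<ge> N. (\<exists>k :: nat. n = 2 ^ k) \<longrightarrow>
       (\<exists>PP \<subseteq> grid_point_sets n.
          real (card PP) \<ge> 2 powr (c'' * real n * log 2 (real n)) \<and>
          (\<forall>P1 \<in> PP. \<forall>P2 \<in> PP. P1 \<noteq> P2 \<longrightarrow>
             real_of_int (disc (mset_set P1 + mset_set P2) axis_rectangles)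
               \<ge> c * log 2 (real n))))"
proof (rule exI[of _ "1/5000000"], rule exI[of _ "1/384"], intro conjI exI[of _ "2^6"] allI impI)
  fix n :: nat assume n: "2^6 \<le> n" and "\<exists>k. n = 2^k"
  then obtain k where nk: "n = 2^k" by blast
  have k: "6 \<le> k" using n unfolding nk by (rule power_le_imp_le_exp[rotated]) simp
  \<comment> \<open>\<open>M\<close> counts the levels with \<open>3a + 4 <= k\<close>. Both
    constants come from \<open>k <= 6 * M\<close>: \<open>6 * 786432 <= 5000000\<close>, and a
    quarter of \<open>M * n / 16\<close> is at least \<open>k * n / 384\<close>.\<close>
  define M where "M = (k - 1) div 3"
  have levels: "3 * a + 4 \<le> k" if "a < M" for a
    using that k unfolding M_def by linarith
  have "k \<le> 6 * M" using k unfolding M_def by linarith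
  then have M: "real k / 6 \<le> real M" by linarith
  have log: "log 2 (real n) = real k" by (simp add: nk)
  obtain F where F: "F \<subseteq> Pow (flips k M)" "2 powr (real (card (flips k M)) / 4) \<le> real (card F)"
    and far: "\<And>A B. A \<in> F \<Longrightarrow> B \<in> F \<Longrightarrow> A \<noteq> B \<Longrightarrow> card (flips k M) < 8 * card (sym_diff A B)"
    using gilbert_varshamov[OF finite_flips] by metis
  have cf: "card (flips k M) = M * 2^(k-4)" using levels by (rule card_flips)
  show "\<exists>PP \<subseteq> grid_point_sets n.
          real (card PP) \<ge> 2 powr (1/384 * real n * log 2 (real n)) \<and>
          (\<forall>P1 \<in> PP. \<forall>P2 \<in> PP. P1 \<noteq> P2 \<longrightarrow>
             real_of_int (disc (mset_set P1 + mset_set P2) axis_rectangles)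
               \<ge> 1/5000000 * log 2 (real n))"
  proof (intro exI[of _ "net k ` F"] conjI ballI impI)
    show "net k ` F \<subseteq> grid_point_sets n"
      using net_in_grid_point_sets nk by auto
    have "(2::real)^4 * 2^(k-4) = real n" unfolding nk power_add[symmetric] using k by simp
    then have n16: "(2::real)^(k-4) = real n / 16" by simp
    have "real n * (real k / 6) \<le> real n * real M" using M by (intro mult_left_mono) auto
    then have "1/384 * real n * log 2 (real n) \<le> real (card (flips k M)) / 4"
      by (simp add: cf n16 log mult.commute)
    then have "2 powr (1/384 * real n * log 2 (real n)) \<le> 2 powr (real (card (flips k M)) / 4)"
      by simp
    also have "\<dots> \<le> real (card F)" by (rule F)
    also have "card F = card (net k ` F)"
      using inj_on_subset[OF inj_on_net[OF levels] F(1)] by (simp add: card_image)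
    finally show "2 powr (1/384 * real n * log 2 (real n)) \<le> real (card (net k ` F))" .
    fix P1 P2 assume "P1 \<in> net k ` F" "P2 \<in> net k ` F" "P1 \<noteq> P2"
    then obtain S1 S2 where S: "S1 \<in> F" "S2 \<in> F" "S1 \<noteq> S2" "P1 = net k S1" "P2 = net k S2" by blast
    have "real M / 786432 \<le> real_of_int (disc (mset_set P1 + mset_set P2) axis_rectangles)"
      unfolding S(4,5) using S(1,2) F(1) far[OF S(1-3)] levels k
      by (intro disc_nets_ge) (auto simp: cf)
    then show "1/5000000 * log 2 (real n) \<le> real_of_int (disc (mset_set P1 + mset_set P2) axis_rectangles)"
      using M unfolding log by linarith
  qed
qed simp_all

end
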